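(* Let $N\in\mathbb{N}$, $N\ge 1$, let $\lambda_1,\ldots,\lambda_N>0$ be pairwise distinct real numbers, and let $X_1,\ldots,X_N$ be independent real random variables such that, for each $n$, $X_n$ is exponentially distributed with parameter $\lambda_n$, i.e. has density $f_n(x)=\lambda_n e^{-\lambda_n x}$, $x\ge 0$. Then the sum $S_N=\sum_{n=1}^N X_n$ has the probability density function $$f_{S_N}(z)=\sum_{n=1}^N\Bigg(\prod_{\substack{j=1\\ j\ne n}}^N\frac{\lambda_j}{\lambda_j-\lambda_n}\Bigg) f_n(z),\qquad z\ge 0.$$
   Context: The exponential distribution with parameter (rate) $\lambda>0$ is the distribution on $[0,\infty)$ with density $x\mapsto\lambda e^{-\lambda x}$ with respect to Lebesgue measure on $[0,\infty)$ (density zero on $(-\infty,0)$). All densities are with respect to Lebesgue measure on $[0,\infty)$. An empty product equals $1$. *)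

theory Defs
  imports "HOL-Probability.Probability"
begin

(* exponential_density l vanishes on the negative half-line, hence so does this function. *)
definition hypoexponential_density :: "nat \<Rightarrow> (nat \<Rightarrow> real) \<Rightarrow> real \<Rightarrow> real" where
  "hypoexponential_density N l z =
     (\<Sum>n = 1..N. (\<Prod>j \<in> {1..N} - {n}. l j / (l j - l n)) * exponential_density (l n) z)"

end

theory Submission
  imports Defs
begin

text \<open>
  The density of a sum of independent variables is the convolution of the densities, so the
  claim is proved by adding one variable at a time. Let \<open>P I t = (\<Prod>j\<in>I. l j / (l j - t))\<close>;
  for small \<open>t\<close> this is the moment generating function of the sum over \<open>I\<close>, and the weight of
  the rate \<open>l n\<close> in the asserted density is \<open>P (I - {n}) (l n)\<close>. Convolving
  that mixture for \<open>I\<close> with the density for a new rate \<open>l k\<close> is an elementary integral of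
  exponentials. It multiplies each old weight by \<open>l k / (l k - l n)\<close>, which is precisely the new
  factor that the formula requires, and collects everything else in a single multiple of
  \<open>exp (- l k * z)\<close>. That the multiple is the right one, \<open>l k * P I (l k)\<close>, is the partial
  fraction expansion of \<open>P I\<close> evaluated at \<open>l k\<close> (lemma \<open>partial_fractions\<close>).

  The weights alternate in sign once the rates are sorted, so nonnegativity of the density is not visible from the formula.
  It comes from the same induction, since a convolution of nonnegative functions is nonnegative.
  The induction runs over arbitrary finite nonempty index sets; it cannot start at the empty set,
  where the sum has no density and the expansion would read \<open>0 = 1\<close>.
\<close>

definition hypoexp_weight :: "'i set \<Rightarrow> ('i \<Rightarrow> 'b::field) \<Rightarrow> 'i \<Rightarrow> 'b" where
  "hypoexp_weight I l n = (\<Prod>j \<in> I - {n}. l j / (l j - l n))"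

definition hypoexp_on :: "'i set \<Rightarrow> ('i \<Rightarrow> real) \<Rightarrow> real \<Rightarrow> real" where
  "hypoexp_on I l z = (\<Sum>n \<in> I. hypoexp_weight I l n * exponential_density (l n) z)"

lemma hypoexp_weight_insert_old:
  assumes "finite I" "k \<notin> I" "n \<in> I"
  shows "hypoexp_weight (insert k I) l n = l k / (l k - l n) * hypoexp_weight I l n"
proof -
  have "insert k I - {n} = insert k (I - {n})"
    using assms by auto
  then show ?thesis
    using assms by (simp add: hypoexp_weight_def)
qed

lemma hypoexp_weight_insert_new:
  assumes "k \<notin> I"
  shows "hypoexp_weight (insert k I) l k = (\<Prod>j \<in> I. l j / (l j - l k))"
  using assms by (simp add: hypoexp_weight_def)

text \<open>
  The induction adds a factor \<open>l k / (l k - t)\<close> and splits each product of two poles by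
  \<open>(l k - t) / ((l k - l n) * (l n - t)) = 1 / (l n - t) - 1 / (l n - l k)\<close>. The hypothesis is thus
  used twice, at \<open>t\<close> and at \<open>l k\<close>; its value at \<open>l k\<close> is the weight of the new pole, so that
  contribution cancels against the new summand.
\<close>

lemma partial_fractions:
  fixes l :: "'i \<Rightarrow> 'b::field"
  assumes "finite I" "I \<noteq> {}" "inj_on l I" "t \<notin> l ` I"
  shows "(\<Sum>n \<in> I. hypoexp_weight I l n * (l n / (l n - t))) = (\<Prod>j \<in> I. l j / (l j - t))"
  using assms
proof (induction I arbitrary: t rule: finite_ne_induct)
  case (singleton k)
  then show ?case
    by (simp add: hypoexp_weight_def)
next
  case (insert k I)
  let ?w = "hypoexp_weight I l" and ?P = "\<lambda>t. \<Prod>j \<in> I. l j / (l j - t)"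
  have inj: "inj_on l I" and k: "l k \<notin> l ` I" and t: "t \<noteq> l k" "t \<notin> l ` I"
    using insert.prems insert.hyps by auto
  have split: "l k / (l k - l n) * ?w n * (l n / (l n - t)) =
      l k / (l k - t) * (?w n * (l n / (l n - t)) - ?w n * (l n / (l n - l k)))" if "n \<in> I" for n
  proof -
    have "l n - t \<noteq> 0" "l k - l n \<noteq> 0" "l n - l k \<noteq> 0" "l k - t \<noteq> 0"
      using that k t by (auto simp: image_iff)
    then have poles: "1 / (l k - l n) * (1 / (l n - t)) =
        1 / (l k - t) * (1 / (l n - t) - 1 / (l n - l k))"
      by (simp add: divide_simps) (simp add: algebra_simps)
    have "l k / (l k - l n) * ?w n * (l n / (l n - t)) =
        l k * l n * ?w n * (1 / (l k - l n) * (1 / (l n - t)))"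
      by (simp add: mult_ac)
    also have "\<dots> = l k / (l k - t) * (?w n * (l n / (l n - t)) - ?w n * (l n / (l n - l k)))"
      unfolding poles by (simp add: divide_inverse algebra_simps)
    finally show ?thesis .
  qed
  have "(\<Sum>n \<in> insert k I. hypoexp_weight (insert k I) l n * (l n / (l n - t))) =
      ?P (l k) * (l k / (l k - t)) + (\<Sum>n \<in> I. l k / (l k - l n) * ?w n * (l n / (l n - t)))"
    using insert.hyps
    by (simp add: hypoexp_weight_insert_old hypoexp_weight_insert_new del: times_divide_eq_left times_divide_eq_right)
  also have "(\<Sum>n \<in> I. l k / (l k - l n) * ?w n * (l n / (l n - t))) =
      l k / (l k - t) * ((\<Sum>n \<in> I. ?w n * (l n / (l n - t))) - (\<Sum>n \<in> I. ?w n * (l n / (l n - l k))))"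
    unfolding sum_subtractf[symmetric] sum_distrib_left by (intro sum.cong refl split)
  also have "\<dots> = l k / (l k - t) * (?P t - ?P (l k))"
    using insert.IH[OF inj t(2)] insert.IH[OF inj k] by simp
  also have "?P (l k) * (l k / (l k - t)) + \<dots> = (\<Prod>j \<in> insert k I. l j / (l j - t))"
    using insert.hyps by (simp add: algebra_simps)
  finally show ?case .
qed

lemma hypoexp_on_singleton [simp]: "hypoexp_on {k} l = exponential_density (l k)"
  by (simp add: fun_eq_iff hypoexp_on_def hypoexp_weight_def)

lemma hypoexp_on_neg: "z < 0 \<Longrightarrow> hypoexp_on I l z = 0"
  by (simp add: hypoexp_on_def exponential_density_def)

lemma borel_measurable_hypoexp_on [measurable]: "hypoexp_on I l \<in> borel_measurable borel"
  unfolding hypoexp_on_def by measurable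

text \<open>
  The convolution step. On \<open>{0..z}\<close> the integrand is a combination of the functions
  \<open>\<lambda>y. exp (- l n * y - l k * (z - y))\<close>, so it has an explicit primitive. The upper limit yields
  the terms of the old rates, and the lower limit the partial fraction expansion at \<open>l k\<close>.
\<close>

lemma hypoexp_on_convolution:
  assumes fin: "finite I" "I \<noteq> {}" and k: "k \<notin> I" and inj: "inj_on l (insert k I)"
    and pos: "0 < l k" and nonneg: "\<And>y. 0 \<le> hypoexp_on I l y"
  shows "(\<integral>\<^sup>+y. ennreal (exponential_density (l k) (z - y)) * ennreal (hypoexp_on I l y) \<partial>lborel)
      = ennreal (hypoexp_on (insert k I) l z)"
    and "0 \<le> hypoexp_on (insert k I) l z"
proof -
  let ?g = "\<lambda>y. exponential_density (l k) (z - y) * hypoexp_on I l y"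
  let ?conv = "\<integral>\<^sup>+y. ennreal (exponential_density (l k) (z - y)) * ennreal (hypoexp_on I l y) \<partial>lborel"
  have "?conv = ennreal (hypoexp_on (insert k I) l z) \<and> 0 \<le> hypoexp_on (insert k I) l z"
  proof (cases "z < 0")
    case True
    have zero: "ennreal (exponential_density (l k) (z - y)) * ennreal (hypoexp_on I l y) = 0" for y
      using True by (cases "y < 0") (auto simp: hypoexp_on_neg exponential_density_def)
    show ?thesis
      using True unfolding zero by (simp add: hypoexp_on_neg)
  next
    case False
    define w where "w = hypoexp_weight I l"
    define F where "F y = (\<Sum>n \<in> I. w n * (l n * l k / (l k - l n)) * exp (- y * l n - (z - y) * l k))" for y
    have neq: "l k \<noteq> l n" if "n \<in> I" for n
      using that k inj by (auto simp: inj_on_def)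
    have g_nonneg: "0 \<le> ?g y" for y
      using pos nonneg by (simp add: exponential_density_nonneg)
    have g_eq: "?g y = (\<Sum>n \<in> I. w n * (l n * l k) * exp (- y * l n - (z - y) * l k))"
      if "y \<in> {0..z}" for y
    proof -
      have "?g y = (\<Sum>n \<in> I. l k * exp (- (z - y) * l k) * (w n * (l n * exp (- y * l n))))"
        using that by (simp add: hypoexp_on_def exponential_density_def w_def sum_distrib_left)
      also have "\<dots> = (\<Sum>n \<in> I. w n * (l n * l k) * exp (- y * l n - (z - y) * l k))"
        by (intro sum.cong refl) (simp add: exp_diff exp_minus exp_add field_simps)
      finally show ?thesis .
    qed
    have deriv: "(F has_real_derivative ?g y) (at y)" if "y \<in> {0..z}" for y
    proof -
      have "(F has_real_derivative (\<Sum>n \<in> I. w n * (l n * l k) * exp (- y * l n - (z - y) * l k)))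
(at y)"
        unfolding F_def
      proof (intro DERIV_sum)
        fix n assume "n \<in> I"
        with neq have eq: "w n * (l n * l k) * exp (- y * l n - (z - y) * l k) =
            w n * (l n * l k / (l k - l n)) * (exp (- y * l n - (z - y) * l k) * (l k - l n))"
          by simp
        show "((\<lambda>y. w n * (l n * l k / (l k - l n)) * exp (- y * l n - (z - y) * l k))
            has_real_derivative w n * (l n * l k) * exp (- y * l n - (z - y) * l k)) (at y)"
          unfolding eq by (rule DERIV_cmult) (auto intro!: derivative_eq_intros)
      qed
      with g_eq[OF that] show ?thesis by simp
    qed
    \<comment> \<open>Outside \<open>{0..z}\<close> one of the two factors has a negative argument and vanishes.\<close>
    have "?conv = (\<integral>\<^sup>+y. ennreal (?g y) * indicator {0..z} y \<partial>lborel)"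
      using nonneg pos
      by (intro nn_integral_cong)
         (auto simp: hypoexp_on_neg exponential_density_def ennreal_mult split: split_indicator)
    also have "\<dots> = ennreal (F z - F 0)"
      using False deriv g_nonneg by (intro nn_integral_FTC_Icc) auto
    finally have conv: "?conv = ennreal (F z - F 0)" .
    have "\<exists>d. (F has_real_derivative d) (at y) \<and> 0 \<le> d" if "0 \<le> y" "y \<le> z" for y
      using that by (intro exI[of _ "?g y"] conjI deriv g_nonneg) simp
    then have F_mono: "F 0 \<le> F z"
      using False by (intro DERIV_nonneg_imp_nondecreasing[of 0 z F]) auto
    have F_z: "F z = (\<Sum>n \<in> I. hypoexp_weight (insert k I) l n * exponential_density (l n) z)"
      unfolding F_def using False fin k
      by (intro sum.cong refl)
         (simp add: hypoexp_weight_insert_old exponential_density_def w_def field_simps)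
    have "- F 0 = (\<Sum>n \<in> I. w n * (l n / (l n - l k))) * exponential_density (l k) z"
      unfolding F_def sum_negf[symmetric] sum_distrib_right
    proof (intro sum.cong refl)
      fix n
      have "l n / (l n - l k) = - (l n / (l k - l n))"
        by (metis minus_diff_eq minus_divide_right)
      then show "- (w n * (l n * l k / (l k - l n)) * exp (- 0 * l n - (z - 0) * l k)) =
          w n * (l n / (l n - l k)) * exponential_density (l k) z"
        using False by (simp add: exponential_density_def)
    qed
    also have "(\<Sum>n \<in> I. w n * (l n / (l n - l k))) = hypoexp_weight (insert k I) l k"
      unfolding w_def hypoexp_weight_insert_new[OF k]
      using fin inj neq by (intro partial_fractions) auto
    finally have "F z - F 0 = hypoexp_on (insert k I) l z"
      using F_z fin k by (simp add: hypoexp_on_def)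
    with conv F_mono show ?thesis by simp
  qed
  then show "?conv = ennreal (hypoexp_on (insert k I) l z)" "0 \<le> hypoexp_on (insert k I) l z"
    by auto
qed

lemma hypoexp_on_nonneg:
  assumes "finite I" "I \<noteq> {}" "inj_on l I" "\<And>n. n \<in> I \<Longrightarrow> 0 < l n"
  shows "0 \<le> hypoexp_on I l z"
  using assms
proof (induction I arbitrary: z rule: finite_ne_induct)
  case (singleton k)
  then show ?case
    by (simp add: exponential_density_nonneg)
next
  case (insert k I)
  then show ?case
    by (intro hypoexp_on_convolution(2)) auto
qed

lemma (in prob_space) distributed_sum_exponential:
  assumes "finite I" "I \<noteq> {}" "inj_on l I" "\<And>n. n \<in> I \<Longrightarrow> 0 < l n"
    and "indep_vars (\<lambda>_. borel) X I"
    and "\<And>n. n \<in> I \<Longrightarrow> distributed M lborel (X n) (exponential_density (l n))"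
  shows "distributed M lborel (\<lambda>\<omega>. \<Sum>n \<in> I. X n \<omega>) (hypoexp_on I l)"
  using assms
proof (induction I rule: finite_ne_induct)
  case (singleton k)
  then show ?case
    by simp
next
  case (insert k I)
  have "distributed M lborel (\<lambda>\<omega>. \<Sum>n \<in> I. X n \<omega>) (hypoexp_on I l)"
    using insert by (intro insert.IH) (auto intro: indep_vars_subset)
  moreover have "indep_var borel (X k) borel (\<lambda>\<omega>. \<Sum>n \<in> I. X n \<omega>)"
    using insert by (intro indep_vars_sum) auto
  ultimately have "distributed M lborel (\<lambda>\<omega>. X k \<omega> + (\<Sum>n \<in> I. X n \<omega>))
      (\<lambda>z. \<integral>\<^sup>+y. ennreal (exponential_density (l k) (z - y)) * ennreal (hypoexp_on I l y) \<partial>lborel)"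
    using insert.prems by (intro distributed_convolution) auto
  also have "(\<lambda>z. \<integral>\<^sup>+y. ennreal (exponential_density (l k) (z - y)) * ennreal (hypoexp_on I l y) \<partial>lborel)
      = (\<lambda>z. ennreal (hypoexp_on (insert k I) l z))"
    using insert by (intro ext hypoexp_on_convolution(1) hypoexp_on_nonneg) auto
  finally show ?case
    using insert.hyps by simp
qed

theorem proposition3p1:
  fixes M :: "'a measure" and N :: nat
    and l :: "nat \<Rightarrow> real" and X :: "nat \<Rightarrow> 'a \<Rightarrow> real"
  assumes "prob_space M"
    and "N \<ge> 1"
    and "\<And>n. n \<in> {1..N} \<Longrightarrow> l n > 0"
    and "inj_on l {1..N}"
    and "prob_space.indep_vars M (\<lambda>_. borel) X {1..N}"
    and "\<And>n. n \<in> {1..N} \<Longrightarrow>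
           distributed M lborel (X n) (\<lambda>x. ennreal (exponential_density (l n) x))"
  shows "(\<forall>z. 0 \<le> hypoexponential_density N l z) \<and>
         distributed M lborel (\<lambda>\<omega>. \<Sum>n = 1..N. X n \<omega>)
           (\<lambda>z. ennreal (hypoexponential_density N l z))"
proof -
  interpret prob_space M by fact
  have eq: "hypoexponential_density N l = hypoexp_on {1..N} l"
    by (simp add: fun_eq_iff hypoexponential_density_def hypoexp_on_def hypoexp_weight_def)
  have "{1..N} \<noteq> {}"
    using \<open>N \<ge> 1\<close> by simp
  then show ?thesis
    unfolding eq using assms(3-6)
    by (intro conjI allI hypoexp_on_nonneg distributed_sum_exponential) auto
qed

end
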